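(* Let $(A,\prec,\succ,\alpha)$ be a Hom-dendriform algebra. Define the linear map $\rhd\colon A\otimes A\to A$ by $$x\rhd y=x\succ y-y\prec x$$ for $x,y\in A$. Then $A_l=(A,\rhd,\alpha)$ is a left Hom-preLie algebra.
   Context: $\mathbb{K}$ is a fixed field of characteristic $0$; all maps are $\mathbb{K}$-linear. A Hom-dendriform algebra is $(A,\prec,\succ,\alpha)$ with $A$ a $\mathbb{K}$-module, linear maps $\prec,\succ\colon A\otimes A\to A$ and $\alpha\colon A\to A$ satisfying, for all $x,y,z\in A$: $(x\prec y)\prec\alpha(z)=\alpha(x)\prec(y\prec z+y\succ z)$; $(x\succ y)\prec\alpha(z)=\alpha(x)\succ(y\prec z)$; $(x\prec y+x\succ y)\succ\alpha(z)=\alpha(x)\succ(y\succ z)$. A left Hom-preLie algebra is a triple $(A,\mu,\alpha)$ with $A$ a $\mathbb{K}$-module, $\mu$ bilinear on $A$ and $\alpha\colon A\to A$ linear, satisfying $\mu(\alpha(x),\mu(y,z))-\mu(\alpha(y),\mu(x,z))=\mu(\mu(x,y),\alpha(z))-\mu(\mu(y,x),\alpha(z))$ for all $x,y,z\in A$. *)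

theory Defs
  imports Complex_Main
begin

text \<open>
  The underlying module is a type \<open>'a\<close> together with a scalar multiplication
  \<open>scale\<close> by a field \<open>'k\<close> of characteristic 0.  A linear map out of the tensor
  square of the module is represented, through the universal property of the
  tensor product, by the corresponding bilinear map.
\<close>

locale bilinear_operation = vector_space scale
  for scale :: "'k::field_char_0 \<Rightarrow> 'a::ab_group_add \<Rightarrow> 'a" +
  fixes mult :: "'a \<Rightarrow> 'a \<Rightarrow> 'a"
  assumes linear_right: "Vector_Spaces.linear scale scale (\<lambda>y. mult x y)"
    and linear_left: "Vector_Spaces.linear scale scale (\<lambda>x. mult x y)"

locale hom_dendriform_algebra =
  prec: bilinear_operation scale dprec +
  succ: bilinear_operation scale dsucc +
  twist: Vector_Spaces.linear scale scale \<alpha>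
  for scale :: "'k::field_char_0 \<Rightarrow> 'a::ab_group_add \<Rightarrow> 'a"
    and dprec :: "'a \<Rightarrow> 'a \<Rightarrow> 'a"  (infixl \<open>\<prec>\<close> 70)
    and dsucc :: "'a \<Rightarrow> 'a \<Rightarrow> 'a"  (infixl \<open>\<succ>\<close> 70)
    and \<alpha> :: "'a \<Rightarrow> 'a" +
  assumes prec_prec: "(x \<prec> y) \<prec> \<alpha> z = \<alpha> x \<prec> (y \<prec> z + y \<succ> z)"
    and succ_prec: "(x \<succ> y) \<prec> \<alpha> z = \<alpha> x \<succ> (y \<prec> z)"
    and succ_succ: "(x \<prec> y + x \<succ> y) \<succ> \<alpha> z = \<alpha> x \<succ> (y \<succ> z)"

locale left_hom_preLie_algebra =
  mult: bilinear_operation scale \<mu> +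
  twist: Vector_Spaces.linear scale scale \<alpha>
  for scale :: "'k::field_char_0 \<Rightarrow> 'a::ab_group_add \<Rightarrow> 'a"
    and \<mu> :: "'a \<Rightarrow> 'a \<Rightarrow> 'a"
    and \<alpha> :: "'a \<Rightarrow> 'a" +
  assumes left_hom_preLie:
    "\<mu> (\<alpha> x) (\<mu> y z) - \<mu> (\<alpha> y) (\<mu> x z) = \<mu> (\<mu> x y) (\<alpha> z) - \<mu> (\<mu> y x) (\<alpha> z)"

definition dendriform_rhd ::
    "('a::ab_group_add \<Rightarrow> 'a \<Rightarrow> 'a) \<Rightarrow> ('a \<Rightarrow> 'a \<Rightarrow> 'a) \<Rightarrow> 'a \<Rightarrow> 'a \<Rightarrow> 'a"
  where "dendriform_rhd dprec dsucc x y = dsucc x y - dprec y x"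

end

theory Submission
  imports Defs
begin

text \<open>Write x * y = x \<prec> y + x \<succ> y. By the dendriform axioms, \<alpha> x \<rhd> (y
  \<rhd> z) equals (x * y) \<succ> \<alpha> z + \<alpha> z \<prec> (y * x) minus a part symmetric in
  x and y. Antisymmetrising in x and y gives [x,y] \<rhd> \<alpha> z with [x,y] = x * y - y * x.
  This is the right-hand side, since \<open>dendriform_rhd\<close> has the same commutator: x \<rhd>
  y - y \<rhd> x = [x,y].\<close>

context bilinear_operation
begin

lemma add_left: "mult (x + y) z = mult x z + mult y z"
  using linear_left by (rule module_hom.add[OF Vector_Spaces.linear.axioms(3)])

lemma add_right: "mult x (y + z) = mult x y + mult x z"
  using linear_right by (rule module_hom.add[OF Vector_Spaces.linear.axioms(3)])

lemma diff_left: "mult (x - y) z = mult x z - mult y z"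
  using add_left[of "x - y" y z] by (simp add: algebra_simps)

lemma diff_right: "mult x (y - z) = mult x y - mult x z"
  using add_right[of x "y - z" z] by (simp add: algebra_simps)

end

text \<open>In each argument the operation is a pointwise difference of linear maps; the flip in
  \<open>dprec y x\<close> makes \<open>prec.linear_left\<close> serve the right argument and vice
  versa.\<close>

lemma bilinear_operation_dendriform_rhd:
  assumes "bilinear_operation scale dprec" and "bilinear_operation scale dsucc"
  shows "bilinear_operation scale (dendriform_rhd dprec dsucc)"
proof -
  interpret prec: bilinear_operation scale dprec by fact
  interpret succ: bilinear_operation scale dsucc by fact
  interpret vector_space_pair scale scale ..
  show ?thesis
    unfolding dendriform_rhd_def
    by (intro bilinear_operation.intro bilinear_operation_axioms.intro linear_compose_sub
        prec.vector_space_axioms prec.linear_left prec.linear_right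
        succ.linear_left succ.linear_right)
qed

theorem theorem6p7:
  fixes scale :: "'k::field_char_0 \<Rightarrow> 'a::ab_group_add \<Rightarrow> 'a"
    and dprec dsucc :: "'a \<Rightarrow> 'a \<Rightarrow> 'a"
    and \<alpha> :: "'a \<Rightarrow> 'a"
  assumes "hom_dendriform_algebra scale dprec dsucc \<alpha>"
  shows "left_hom_preLie_algebra scale (dendriform_rhd dprec dsucc) \<alpha>"
proof -
  interpret hom_dendriform_algebra scale dprec dsucc \<alpha> by fact
  interpret rhd: bilinear_operation scale "dendriform_rhd dprec dsucc"
    by (intro bilinear_operation_dendriform_rhd prec.bilinear_operation_axioms
        succ.bilinear_operation_axioms)
  show ?thesis
  \<comment> \<open>The interpretation \<open>rhd\<close> and the linearity of
    \<open>\<alpha>\<close> discharge the other locale assumptions, leaving only the Hom-preLie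
    identity.\<close>
  proof
    fix x y z
    show "dendriform_rhd dprec dsucc (\<alpha> x) (dendriform_rhd dprec dsucc y z)
        - dendriform_rhd dprec dsucc (\<alpha> y) (dendriform_rhd dprec dsucc x z)
      = dendriform_rhd dprec dsucc (dendriform_rhd dprec dsucc x y) (\<alpha> z)
        - dendriform_rhd dprec dsucc (dendriform_rhd dprec dsucc y x) (\<alpha> z)"
      \<comment> \<open>The mixed terms \<open>dprec (dsucc x z) (\<alpha> y)\<close> and \<open>dprec (dsucc y z) (\<alpha> x)\<close>
        occur symmetrically on the left and cancel.\<close>
      by (simp add: dendriform_rhd_def prec.diff_left prec.diff_right succ.diff_left succ.diff_right
          prec_prec prec.add_right succ_prec succ_succ[symmetric] succ.add_left algebra_simps)
  qed
qed

end
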